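(* Let $0<p\le1$, $q>1$, and let $s$ be a positive integer. Assume that $\bm{A}\in\mathbb{R}^{m\times n}$ satisfies $$\inf_{\bm{h}\in\ker(\bm{A})\setminus\{\bm{0}\}}\frac{\|\bm{h}\|_p}{\|\bm{h}\|_q}>3^{1/p}s^{1/p-1/q}.$$ Then every nonzero $s$-sparse vector $\bm{x}_0\in\mathbb{R}^n$ is the unique global minimizer of the problem $$\inf_{\bm{x}\in\mathbb{R}^n\setminus\{\bm{0}\}}\left\{\frac{\|\bm{x}\|_p^p}{\|\bm{x}\|_q^p}\;\middle|\;\bm{A}\bm{x}=\bm{b}\right\}\quad\text{with }\bm{b}=\bm{A}\bm{x}_0.$$ Consequently this minimization exactly recovers all nonzero $s$-sparse signals.
   Context: For $0<r<\infty$, $\|\bm{u}\|_r:=(\sum_i|u_i|^r)^{1/r}$ (a quasi-norm if $r<1$). A vector is $s$-sparse if it has at most $s$ nonzero entries. The infimum over an empty set is $+\infty$. *)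

theory Defs
  imports "HOL-Analysis.Analysis"
begin

text \<open>Real exponents \<open>0 < r < \<infinity>\<close> only; a quasi-norm for \<open>r < 1\<close>.
  Zero entries contribute 0, since \<open>0 powr r = 0\<close>.\<close>
definition lp_norm :: "real \<Rightarrow> real ^ 'n \<Rightarrow> real" where
  "lp_norm r u = (\<Sum>i\<in>UNIV. \<bar>u $ i\<bar> powr r) powr (1 / r)"

definition s_sparse :: "nat \<Rightarrow> real ^ 'n \<Rightarrow> bool" where
  "s_sparse s u \<longleftrightarrow> card {i. u $ i \<noteq> 0} \<le> s"

definition mat_ker :: "real ^ 'n ^ 'm \<Rightarrow> (real ^ 'n) set" where
  "mat_ker A = {h. A *v h = 0}"

text \<open>The infimum is taken in \<^typ>\<open>ereal\<close>, so that it is \<open>\<infinity>\<close> when the kernel is trivial.\<close>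
definition kernel_ratio :: "real \<Rightarrow> real \<Rightarrow> real ^ 'n ^ 'm \<Rightarrow> ereal" where
  "kernel_ratio p q A = (INF h \<in> mat_ker A - {0}. ereal (lp_norm p h / lp_norm q h))"

definition objective :: "real \<Rightarrow> real \<Rightarrow> real ^ 'n \<Rightarrow> real" where
  "objective p q x = lp_norm p x powr p / lp_norm q x powr p"

definition feasible :: "real ^ 'n ^ 'm \<Rightarrow> real ^ 'm \<Rightarrow> real ^ 'n \<Rightarrow> bool" where
  "feasible A b x \<longleftrightarrow> x \<noteq> 0 \<and> A *v x = b"

definition minimizers :: "real \<Rightarrow> real \<Rightarrow> real ^ 'n ^ 'm \<Rightarrow> real ^ 'm \<Rightarrow> (real ^ 'n) set" where
  "minimizers p q A b = {x. is_arg_min (objective p q) (feasible A b) x}"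

definition unique_global_minimizer :: "('a \<Rightarrow> real) \<Rightarrow> ('a \<Rightarrow> bool) \<Rightarrow> 'a \<Rightarrow> bool" where
  "unique_global_minimizer f P x \<longleftrightarrow>
     is_arg_min f P x \<and> (\<forall>y. is_arg_min f P y \<longrightarrow> y = x)"

text \<open>Exact recovery: from the measurements \<open>A *v x0\<close> alone, the minimization returns \<open>x0\<close>
  and nothing else.\<close>
definition exactly_recovers :: "real \<Rightarrow> real \<Rightarrow> real ^ 'n ^ 'm \<Rightarrow> (real ^ 'n) set \<Rightarrow> bool" where
  "exactly_recovers p q A X \<longleftrightarrow> (\<forall>x0\<in>X. minimizers p q A (A *v x0) = {x0})"

end

theory Submission
  imports Defs
begin

text \<open>Write \<open>x = x0 + h\<close> with \<open>h\<close> a nonzero kernel vector and let \<open>S\<close> be the support of \<open>x0\<close>.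
  Subadditivity of \<open>t powr p\<close>, applied on \<open>S\<close> and off \<open>S\<close>, gives
  \<open>\<parallel>x\<parallel>\<^sub>p\<^sup>p \<ge> \<parallel>x0\<parallel>\<^sub>p\<^sup>p + \<parallel>h\<parallel>\<^sub>p\<^sup>p - 2 \<parallel>h\<^sub>S\<parallel>\<^sub>p\<^sup>p\<close>, and the Hoelder bound
  \<open>\<parallel>h\<^sub>S\<parallel>\<^sub>p\<^sup>p \<le> c \<parallel>h\<parallel>\<^sub>q\<^sup>p\<close> with \<open>c = s powr (1 - p / q)\<close> turns the hypothesis \<open>\<parallel>h\<parallel>\<^sub>p\<^sup>p > 3 c \<parallel>h\<parallel>\<^sub>q\<^sup>p\<close>
  into \<open>\<parallel>x\<parallel>\<^sub>p\<^sup>p > \<parallel>x0\<parallel>\<^sub>p\<^sup>p + c \<parallel>h\<parallel>\<^sub>q\<^sup>p\<close>. Since also \<open>\<parallel>x0\<parallel>\<^sub>p\<^sup>p \<le> c \<parallel>x0\<parallel>\<^sub>q\<^sup>p\<close> and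
  \<open>\<parallel>x\<parallel>\<^sub>q\<^sup>p \<le> \<parallel>x0\<parallel>\<^sub>q\<^sup>p + \<parallel>h\<parallel>\<^sub>q\<^sup>p\<close>, the quotient at \<open>x\<close> is strictly larger than at \<open>x0\<close>.\<close>

text \<open>Vector entries may vanish, so convexity on the open half-line is extended to 0. With
  \<open>x < y\<close> only \<open>x\<close> can be 0, and then the claim reduces to
  \<open>t powr r \<le> t\<close>.\<close>

lemma powr_convex_atLeast:
  fixes r :: real
  assumes "r \<ge> 1"
  shows "convex_on {0..} (\<lambda>x. x powr r)"
proof (intro convex_on_linorderI)
  fix t x y :: real
  assume t: "0 < t" "t < 1" and xy: "x \<in> {0..}" "y \<in> {0..}" "x < y"
  show "((1 - t) *\<^sub>R x + t *\<^sub>R y) powr r \<le> (1 - t) * x powr r + t * y powr r"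
  proof (cases "x = 0")
    case True
    have "t powr r \<le> t powr 1"
      using t assms by (intro powr_mono') auto
    then show ?thesis
      using True t xy by (simp add: powr_mult mult_right_mono)
  next
    case False
    then show ?thesis
      using convex_onD[OF powr_convex[OF assms], of t x y] t xy by auto
  qed
qed auto

text \<open>Dividing by \<open>(a + b) powr p\<close> turns both terms into powers of fractions in
  [0,1]. An exponent at most 1 does not decrease such fractions, and the fractions add up to
  1.\<close>

lemma powr_add_le:
  fixes a b p :: real
  assumes "0 < p" "p \<le> 1" "0 \<le> a" "0 \<le> b"
  shows "(a + b) powr p \<le> a powr p + b powr p"
proof (cases "a + b = 0")
  case True
  then show ?thesis using assms by auto
next
  case False
  have le: "x / (a + b) \<le> x powr p / (a + b) powr p" if "0 \<le> x" "x \<le> a + b" for x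
  proof -
    have "(x / (a + b)) powr 1 \<le> (x / (a + b)) powr p"
      using assms False that by (intro powr_mono') auto
    then show ?thesis
      using assms that by (simp add: powr_divide)
  qed
  have "1 = a / (a + b) + b / (a + b)"
    using False by (simp flip: add_divide_distrib)
  also have "\<dots> \<le> (a powr p + b powr p) / (a + b) powr p"
    using le[of a] le[of b] assms by (simp add: add_divide_distrib)
  finally show ?thesis
    using False assms by (simp add: pos_le_divide_eq)
qed

lemma abs_powr_triangle:
  fixes a b p :: real
  assumes "0 < p" "p \<le> 1"
  shows "\<bar>a + b\<bar> powr p \<le> \<bar>a\<bar> powr p + \<bar>b\<bar> powr p"
proof -
  have "\<bar>a + b\<bar> powr p \<le> (\<bar>a\<bar> + \<bar>b\<bar>) powr p"
    using assms by (intro powr_mono2) auto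
  then show ?thesis
    using powr_add_le[OF assms, of "\<bar>a\<bar>" "\<bar>b\<bar>"] by simp
qed

text \<open>Power mean inequality: Jensen for the convex map \<open>x powr (q / p)\<close> with
  uniform weights \<open>1 / k\<close>, applied to the values \<open>a i powr p\<close>.\<close>

lemma sum_powr_le_card_powr:
  fixes a :: "'a \<Rightarrow> real"
  assumes "finite S" "0 < p" "p \<le> q" and nn: "\<And>i. i \<in> S \<Longrightarrow> 0 \<le> a i"
  shows "(\<Sum>i\<in>S. a i powr p) \<le> real (card S) powr (1 - p / q) * (\<Sum>i\<in>S. a i powr q) powr (p / q)"
proof (cases "S = {}")
  case False
  define k where "k = real (card S)"
  have k: "k > 0" using False assms by (simp add: k_def card_gt_0_iff)
  have q: "q > 0" using assms by simp
  define M where "M = (\<Sum>i\<in>S. a i powr p) / k"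
  have M0: "M \<ge> 0" unfolding M_def using k by (intro divide_nonneg_pos sum_nonneg) auto
  have "(\<Sum>i\<in>S. (1 / k) *\<^sub>R (a i powr p)) powr (q / p) \<le> (\<Sum>i\<in>S. (1 / k) * (a i powr p) powr (q / p))"
    using False assms k
    by (intro convex_on_sum[OF _ _ powr_convex_atLeast]) (auto simp: k_def)
  then have "M powr (q / p) \<le> (\<Sum>i\<in>S. a i powr q) / k"
    using assms by (simp add: M_def powr_powr sum_divide_distrib)
  then have "(M powr (q / p)) powr (p / q) \<le> ((\<Sum>i\<in>S. a i powr q) / k) powr (p / q)"
    using assms q by (intro powr_mono2) auto
  then have "M \<le> (\<Sum>i\<in>S. a i powr q) powr (p / q) / k powr (p / q)"
    using assms q k M0 by (simp add: powr_powr powr_divide sum_nonneg)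
  then have "(\<Sum>i\<in>S. a i powr p) \<le> k * ((\<Sum>i\<in>S. a i powr q) powr (p / q) / k powr (p / q))"
    using k by (simp add: M_def pos_divide_le_eq mult.commute)
  also have "\<dots> = k powr (1 - p / q) * (\<Sum>i\<in>S. a i powr q) powr (p / q)"
    using k by (simp add: powr_diff)
  finally show ?thesis by (simp add: k_def)
qed auto

lemma lp_norm_powr:
  assumes "r \<noteq> 0"
  shows "lp_norm r u powr r = (\<Sum>i\<in>UNIV. \<bar>u $ i\<bar> powr r)"
  using assms by (simp add: lp_norm_def powr_powr sum_nonneg)

lemma lp_norm_nonneg: "0 \<le> lp_norm r u"
  by (simp add: lp_norm_def)

lemma lp_norm_zero: "lp_norm r 0 = 0"
  by (simp add: lp_norm_def)

lemma lp_norm_pos: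
  assumes "u \<noteq> 0"
  shows "0 < lp_norm r u"
proof -
  obtain j where "u $ j \<noteq> 0"
    using assms by (auto simp: vec_eq_iff)
  then have "0 < (\<Sum>i\<in>UNIV. \<bar>u $ i\<bar> powr r)"
    by (intro sum_pos2[of _ j]) auto
  then show ?thesis by (simp add: lp_norm_def)
qed

text \<open>Minkowski by normalization: \<open>(u + v) / (a + b)\<close> is the convex combination
  of the unit vectors \<open>u / a\<close> and \<open>v / b\<close> with weights
  \<open>a / (a + b)\<close> and \<open>b / (a + b)\<close>. Convexity of \<open>x powr r\<close> in
  each entry then bounds its power sum by 1.\<close>

lemma lp_norm_triangle:
  fixes u v :: "real ^ 'n"
  assumes "r \<ge> 1"
  shows "lp_norm r (u + v) \<le> lp_norm r u + lp_norm r v"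
proof (cases "u = 0 \<or> v = 0")
  case True
  then show ?thesis by (auto simp: lp_norm_zero)
next
  case False
  define a b where "a = lp_norm r u" and "b = lp_norm r v"
  have ab: "a > 0" "b > 0" using False by (auto simp: a_def b_def lp_norm_pos)
  define t where "t = b / (a + b)"
  have t: "0 \<le> t" "t \<le> 1" and t': "1 - t = a / (a + b)"
    using ab by (auto simp: t_def field_simps)
  have pointwise: "\<bar>(u + v) $ i\<bar> powr r / (a + b) powr r
      \<le> (1 - t) * (\<bar>u $ i\<bar> powr r / a powr r) + t * (\<bar>v $ i\<bar> powr r / b powr r)" for i
  proof -
    have "\<bar>(u + v) $ i\<bar> / (a + b) \<le> \<bar>u $ i\<bar> / (a + b) + \<bar>v $ i\<bar> / (a + b)"
      using ab by (simp add: divide_right_mono abs_triangle_ineq flip: add_divide_distrib)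
    also have "\<dots> = (1 - t) *\<^sub>R (\<bar>u $ i\<bar> / a) + t *\<^sub>R (\<bar>v $ i\<bar> / b)"
      unfolding t' using ab by (simp add: t_def)
    finally have "(\<bar>(u + v) $ i\<bar> / (a + b)) powr r
        \<le> ((1 - t) *\<^sub>R (\<bar>u $ i\<bar> / a) + t *\<^sub>R (\<bar>v $ i\<bar> / b)) powr r"
      using ab assms by (intro powr_mono2) auto
    also have "\<dots> \<le> (1 - t) * (\<bar>u $ i\<bar> / a) powr r + t * (\<bar>v $ i\<bar> / b) powr r"
      using ab t by (intro convex_onD[OF powr_convex_atLeast[OF assms]]) auto
    finally show ?thesis
      using ab by (simp add: powr_divide)
  qed
  have "lp_norm r (u + v) powr r / (a + b) powr r
      = (\<Sum>i\<in>UNIV. \<bar>(u + v) $ i\<bar> powr r / (a + b) powr r)"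
    using assms by (simp add: lp_norm_powr sum_divide_distrib del: vector_add_component)
  also have "\<dots> \<le> (\<Sum>i\<in>UNIV. (1 - t) * (\<bar>u $ i\<bar> powr r / a powr r) + t * (\<bar>v $ i\<bar> powr r / b powr r))"
    by (intro sum_mono pointwise)
  also have "\<dots> = (1 - t) * (lp_norm r u powr r / a powr r) + t * (lp_norm r v powr r / b powr r)"
    using assms by (simp only: lp_norm_powr sum.distrib sum_distrib_left sum_divide_distrib)
  also have "\<dots> = 1"
    using ab by (simp flip: a_def b_def)
  finally have "lp_norm r (u + v) powr r \<le> (a + b) powr r"
    using ab by (simp add: pos_divide_le_eq)
  then have "lp_norm r (u + v) \<le> a + b"
    using powr_less_mono2[of r "a + b" "lp_norm r (u + v)"] ab assms by linarith
  then show ?thesis by (simp add: a_def b_def)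
qed

text \<open>Serves both for a kernel vector restricted to the support of \<open>x0\<close> and for
  \<open>x0\<close> itself. Passing from \<open>card S\<close> to \<open>s\<close> relies on
  \<open>1 - p / q \<ge> 0\<close>.\<close>

lemma sum_support_le_lp_norm:
  fixes u :: "real ^ 'n"
  assumes "0 < p" "p \<le> q" "card S \<le> s"
  shows "(\<Sum>i\<in>S. \<bar>u $ i\<bar> powr p) \<le> real s powr (1 - p / q) * lp_norm q u powr p"
proof -
  have "(\<Sum>i\<in>S. \<bar>u $ i\<bar> powr p)
      \<le> real (card S) powr (1 - p / q) * (\<Sum>i\<in>S. \<bar>u $ i\<bar> powr q) powr (p / q)"
    using assms by (intro sum_powr_le_card_powr) auto
  also have "\<dots> \<le> real s powr (1 - p / q) * (\<Sum>i\<in>UNIV. \<bar>u $ i\<bar> powr q) powr (p / q)"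
    using assms by (intro mult_mono powr_mono2 sum_mono2 sum_nonneg) auto
  also have "(\<Sum>i\<in>UNIV. \<bar>u $ i\<bar> powr q) powr (p / q) = lp_norm q u powr p"
    by (simp add: lp_norm_def powr_powr)
  finally show ?thesis .
qed

text \<open>The \<open>p\<close>-th power of the hypothesis: \<open>3 powr (1 / p)\<close> becomes
  3, and the exponent of \<open>s\<close> becomes \<open>1 - p / q\<close>.\<close>

lemma kernel_ratio_imp:
  fixes A :: "real ^ 'n ^ 'm"
  assumes "0 < p" "A *v h = 0" "h \<noteq> 0"
    and "kernel_ratio p q A > ereal (3 powr (1 / p) * real s powr (1 / p - 1 / q))"
  shows "3 * (real s powr (1 - p / q) * lp_norm q h powr p) < lp_norm p h powr p"
proof -
  have "kernel_ratio p q A \<le> ereal (lp_norm p h / lp_norm q h)"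
    unfolding kernel_ratio_def using assms by (intro INF_lower) (auto simp: mat_ker_def)
  then have "3 powr (1 / p) * real s powr (1 / p - 1 / q) < lp_norm p h / lp_norm q h"
    using assms(4) by (metis less_le_trans less_ereal.simps(1))
  then have "3 powr (1 / p) * real s powr (1 / p - 1 / q) * lp_norm q h < lp_norm p h"
    using lp_norm_pos[OF assms(3)] by (simp add: pos_less_divide_eq)
  then have "(3 powr (1 / p) * real s powr (1 / p - 1 / q) * lp_norm q h) powr p < lp_norm p h powr p"
    using assms by (intro powr_less_mono2) (auto simp: lp_norm_nonneg)
  then show ?thesis
    using assms by (simp add: powr_mult powr_powr lp_norm_nonneg left_diff_distrib mult.assoc)
qed

lemma objective_less:
  fixes A :: "real ^ 'n ^ 'm"
  assumes p: "0 < p" "p \<le> 1" and q: "1 < q"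
    and kr: "kernel_ratio p q A > ereal (3 powr (1 / p) * real s powr (1 / p - 1 / q))"
    and x0: "x0 \<noteq> 0" "s_sparse s x0" and x: "x \<noteq> 0" "A *v x = A *v x0" "x \<noteq> x0"
  shows "objective p q x0 < objective p q x"
proof -
  define h where "h = x - x0"
  define S where "S = {i. x0 $ i \<noteq> 0}"
  define c where "c = real s powr (1 - p / q)"
  let ?P = "\<lambda>u::real^'n. lp_norm p u powr p" and ?Q = "\<lambda>u::real^'n. lp_norm q u powr p"
  have S: "card S \<le> s" using x0 by (simp add: S_def s_sparse_def)
  have h: "A *v h = 0" "h \<noteq> 0"
    using x by (auto simp: h_def matrix_vector_mult_diff_distrib)
  have split: "?P u = (\<Sum>i\<in>S. \<bar>u $ i\<bar> powr p) + (\<Sum>i\<in>-S. \<bar>u $ i\<bar> powr p)" for u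
    using p by (simp add: lp_norm_powr Compl_eq_Diff_UNIV sum.subset_diff[of S UNIV] add.commute)
  have x0_off: "(\<Sum>i\<in>-S. \<bar>x0 $ i\<bar> powr p) = 0"
    by (intro sum.neutral) (auto simp: S_def)
  have x_off: "(\<Sum>i\<in>-S. \<bar>x $ i\<bar> powr p) = (\<Sum>i\<in>-S. \<bar>h $ i\<bar> powr p)"
    by (intro sum.cong) (auto simp: S_def h_def)
  have "(\<Sum>i\<in>S. \<bar>x0 $ i\<bar> powr p) \<le> (\<Sum>i\<in>S. \<bar>x $ i\<bar> powr p + \<bar>h $ i\<bar> powr p)"
  proof (intro sum_mono)
    fix i
    show "\<bar>x0 $ i\<bar> powr p \<le> \<bar>x $ i\<bar> powr p + \<bar>h $ i\<bar> powr p"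
      using abs_powr_triangle[OF p, of "x $ i" "- (h $ i)"] by (simp add: h_def abs_minus_commute)
  qed
  \<comment> \<open>The sum of \<open>h\<close> over \<open>S\<close> is lost twice: once in the
    triangle inequality on \<open>S\<close>, and once because off \<open>S\<close>, where
    \<open>x\<close> equals \<open>h\<close>, only the rest of \<open>?P h\<close> appears.\<close>
  then have "?P x \<ge> ?P x0 + ?P h - 2 * (\<Sum>i\<in>S. \<bar>h $ i\<bar> powr p)"
    using split[of x] split[of x0] split[of h] x0_off x_off by (simp add: sum.distrib)
  moreover have "(\<Sum>i\<in>S. \<bar>h $ i\<bar> powr p) \<le> c * ?Q h"
    unfolding c_def using p q S by (intro sum_support_le_lp_norm) auto
  \<comment> \<open>Two of the three copies of \<open>c * ?Q h\<close> pay for that double loss; the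
    third is the surplus in \<open>Px\<close>.\<close>
  moreover have "3 * (c * ?Q h) < ?P h"
    unfolding c_def using kernel_ratio_imp[OF p(1) h kr] .
  ultimately have Px: "?P x > ?P x0 + c * ?Q h"
    by linarith
  have Px0: "?P x0 \<le> c * ?Q x0"
    using sum_support_le_lp_norm[OF p(1) _ S, of q x0] p q split[of x0] x0_off by (simp add: c_def)
  have "?Q x \<le> (lp_norm q x0 + lp_norm q h) powr p"
    using lp_norm_triangle[of q x0 h] p q
    by (intro powr_mono2) (auto simp: h_def lp_norm_nonneg)
  also have "\<dots> \<le> ?Q x0 + ?Q h"
    using p by (intro powr_add_le lp_norm_nonneg)
  finally have Qx: "?Q x \<le> ?Q x0 + ?Q h" .
  have Q0: "?Q x0 > 0" "?Q x > 0"
    using lp_norm_pos[OF x0(1), of q] lp_norm_pos[OF x(1), of q] by auto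
  \<comment> \<open>The quotients are compared by cross-multiplication; the surplus
    \<open>c * ?Q h\<close>, times \<open>?Q x0\<close>, absorbs the growth of the
    denominator.\<close>
  have "?P x0 * ?Q x \<le> ?P x0 * ?Q x0 + ?P x0 * ?Q h"
    using mult_left_mono[OF Qx, of "?P x0"] by (simp add: distrib_left)
  also have "\<dots> \<le> ?P x0 * ?Q x0 + c * ?Q x0 * ?Q h"
    using mult_right_mono[OF Px0, of "?Q h"] by simp
  also have "\<dots> = (?P x0 + c * ?Q h) * ?Q x0"
    by (simp add: algebra_simps)
  also have "\<dots> < ?P x * ?Q x0"
    using Px Q0 by (intro mult_strict_right_mono)
  finally show ?thesis
    unfolding objective_def using Q0 by (simp add: divide_less_eq less_divide_eq mult.commute)
qed

theorem theorem4p3: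
  fixes A :: "real ^ 'n ^ 'm" and p q :: real and s :: nat
  assumes "0 < p" and "p \<le> 1" and "1 < q" and "0 < s"
    and "kernel_ratio p q A > ereal (3 powr (1 / p) * real s powr (1 / p - 1 / q))"
  shows "(\<forall>x0 b. x0 \<noteq> 0 \<and> s_sparse s x0 \<and> b = A *v x0 \<longrightarrow>
            unique_global_minimizer (objective p q) (feasible A b) x0)
       \<and> exactly_recovers p q A {x0. x0 \<noteq> 0 \<and> s_sparse s x0}"
proof -
  have min: "unique_global_minimizer (objective p q) (feasible A (A *v x0)) x0"
    if x0: "x0 \<noteq> 0" "s_sparse s x0" for x0
  proof -
    \<comment> \<open>Strictness yields minimality and uniqueness at once.\<close>
    have "objective p q x0 < objective p q x" if "feasible A (A *v x0) x" "x \<noteq> x0" for x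
      using objective_less[OF assms(1-3,5) x0] that by (simp add: feasible_def)
    moreover have "feasible A (A *v x0) x0"
      using x0 by (simp add: feasible_def)
    ultimately show ?thesis
      unfolding unique_global_minimizer_def is_arg_min_def by (metis less_asym)
  qed
  then have "minimizers p q A (A *v x0) = {x0}" if "x0 \<noteq> 0" "s_sparse s x0" for x0
    using that by (auto simp: minimizers_def unique_global_minimizer_def)
  with min show ?thesis
    by (auto simp: exactly_recovers_def)
qed

end
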